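(* For every function $f:X\times Y\to\{0,1\}$, $$Q_0^*(f)\;\geq\;\tfrac14\log_2 \mathrm{fool}(f)-\tfrac12 .$$
   Context: $X$ and $Y$ are finite sets; Alice receives $x\in X$ and Bob receives $y\in Y$. Fooling sets. For $b\in\{0,1\}$, a $b$-fooling set for $f$ is a set $F\subseteq X\times Y$ such that (1) $f(x,y)=b$ for all $(x,y)\in F$, and (2) for any two distinct $(x,y),(x',y')\in F$, $f(x,y')\neq b$ or $f(x',y)\neq b$. $\mathrm{fool}(f)$ is the standard maximum fooling set size, i.e., the maximum of the size of the largest 1-fooling set and the size of the largest 0-fooling set of $f$. Quantum protocols with prior entanglement. Alice and Bob start in a fixed state, independent of the inputs, which may be entangled between them without any limit on the amount of entanglement. They then communicate by exchanging qubits, each party applying between messages operations that depend on their own input to the registers they hold. The cost is the worst-case number of qubits communicated. One-sided-error complexity. In a one-sided-error protocol for $f$ the output bit is obtained by measuring the last qubit on the channel; it must be 0 with certainty whenever $f(x,y)=0$, and it must be 1 with probability at least $1/2$ whenever $f(x,y)=1$. $Q_1^*(f)$ is the minimal cost of such a protocol with prior entanglement. Las Vegas complexity. In a quantum Las Vegas protocol Alice and Bob compute $f$ without error, but are allowed to give up without a result with probability at most $1/2$: on every input $(x,y)$ the value $1-f(x,y)$ is never output, and the protocol gives up with probability at most $1/2$. $Q_0^*(f)$ is the minimal worst-case communication of any Las Vegas protocol with prior entanglement for $f$. The convention for how the result is produced is such that a Las Vegas protocol for $f$ yields one-sided-error protocols of the same cost for $f$ and for its negation $\neg f$, i.e.,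 $Q_0^*(f)\geq\max\{Q_1^*(f),Q_1^*(\neg f)\}$. *)

theory Defs
  imports
    Complex_Main
    "Jordan_Normal_Form.Schur_Decomposition"
begin

section \<open>Fooling sets\<close>

definition fooling_set ::
    "'x set \<Rightarrow> 'y set \<Rightarrow> ('x \<Rightarrow> 'y \<Rightarrow> bool) \<Rightarrow> bool \<Rightarrow> ('x \<times> 'y) set \<Rightarrow> bool" where
  "fooling_set X Y f b F \<longleftrightarrow>
     F \<subseteq> X \<times> Y \<and>
     (\<forall>(x, y) \<in> F. f x y = b) \<and>
     (\<forall>(x, y) \<in> F. \<forall>(x', y') \<in> F. (x, y) \<noteq> (x', y') \<longrightarrow> f x y' \<noteq> b \<or> f x' y \<noteq> b)"

definition fool_val :: "'x set \<Rightarrow> 'y set \<Rightarrow> ('x \<Rightarrow> 'y \<Rightarrow> bool) \<Rightarrow> bool \<Rightarrow> nat" where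
  "fool_val X Y f b = Max {card F | F. fooling_set X Y f b F}"

definition fool :: "'x set \<Rightarrow> 'y set \<Rightarrow> ('x \<Rightarrow> 'y \<Rightarrow> bool) \<Rightarrow> nat" where
  "fool X Y f = max (fool_val X Y f True) (fool_val X Y f False)"


section \<open>Quantum protocols with prior entanglement\<close>

text \<open>
  A pure state of Alice's and Bob's registers, of dimensions \<open>a\<close> and \<open>b\<close>, is given by its
  \<open>a \<times> b\<close> coefficient matrix: entry \<open>(i, j)\<close> is the amplitude of \<open>|i\<rangle>|j\<rangle>\<close>.
  A local operator \<open>U\<close> of Alice maps \<open>\<Psi>\<close> to \<open>U * \<Psi>\<close>, and a local operator \<open>V\<close> of Bob maps
  \<open>\<Psi>\<close> to \<open>\<Psi> * V\<^sup>T\<close>.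

  Local operations are isometries, that is, unitaries after adjoining ancillas in a fixed state.
  Together with arbitrary register dimensions this also covers general quantum operations
  (Stinespring dilation) and mixed initial states (purification).
\<close>

definition isometry :: "nat \<Rightarrow> nat \<Rightarrow> complex mat \<Rightarrow> bool" where
  "isometry m n U \<longleftrightarrow> U \<in> carrier_mat m n \<and> mat_adjoint U * U = 1\<^sub>m n"

definition unit_state :: "nat \<Rightarrow> nat \<Rightarrow> complex mat \<Rightarrow> bool" where
  "unit_state a b \<Psi> \<longleftrightarrow>
     \<Psi> \<in> carrier_mat a b \<and> (\<Sum>i<a. \<Sum>j<b. (cmod (\<Psi> $$ (i, j)))\<^sup>2) = 1"

text \<open>
  In a step, one party applies an operation depending on its own input, obtaining a register of
  dimension \<open>2 * d\<close>, that is, a register of dimension \<open>d\<close> that it keeps and one qubit that it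
  sends.  Basis state \<open>2 * i + c\<close> stands for \<open>|i\<rangle>|c\<rangle>\<close>, where \<open>c \<in> {0, 1}\<close> is the value of
  the qubit.  The receiver appends the qubit to its register in the same encoding.  A message of
  several qubits is a sequence of consecutive steps of the same party.
\<close>

datatype ('x, 'y) step =
    AliceSends nat "'x \<Rightarrow> complex mat"
  | BobSends nat "'y \<Rightarrow> complex mat"

definition qubit_to_Bob :: "complex mat \<Rightarrow> complex mat" where
  "qubit_to_Bob \<Psi> =
     mat (dim_row \<Psi> div 2) (2 * dim_col \<Psi>) (\<lambda>(i, j). \<Psi> $$ (2 * i + j mod 2, j div 2))"

definition qubit_to_Alice :: "complex mat \<Rightarrow> complex mat" where
  "qubit_to_Alice \<Psi> =
     mat (2 * dim_row \<Psi>) (dim_col \<Psi> div 2) (\<lambda>(i, j). \<Psi> $$ (i div 2, 2 * j + i mod 2))"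

fun valid_steps :: "'x set \<Rightarrow> 'y set \<Rightarrow> nat \<Rightarrow> nat \<Rightarrow> ('x, 'y) step list \<Rightarrow> bool" where
  "valid_steps X Y a b [] \<longleftrightarrow> True"
| "valid_steps X Y a b (AliceSends d U # ss) \<longleftrightarrow>
     (\<forall>x\<in>X. isometry (2 * d) a (U x)) \<and> valid_steps X Y d (2 * b) ss"
| "valid_steps X Y a b (BobSends d V # ss) \<longleftrightarrow>
     (\<forall>y\<in>Y. isometry (2 * d) b (V y)) \<and> valid_steps X Y (2 * a) d ss"

fun run :: "('x, 'y) step list \<Rightarrow> 'x \<Rightarrow> 'y \<Rightarrow> complex mat \<Rightarrow> complex mat" where
  "run [] x y \<Psi> = \<Psi>"
| "run (AliceSends d U # ss) x y \<Psi> = run ss x y (qubit_to_Bob (U x * \<Psi>))"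
| "run (BobSends d V # ss) x y \<Psi> = run ss x y (qubit_to_Alice (\<Psi> * transpose_mat (V y)))"


section \<open>Las Vegas protocols\<close>

text \<open>
  As for one-sided error, the result bit is obtained by measuring the last qubit on the channel,
  so there is at least one step.  In addition, the sender of that qubit measures the register it
  keeps, and the protocol gives up (\<open>None\<close>) iff the outcome lies in a fixed set \<open>G\<close>.  Since the
  sender can choose the basis by its last operation, this allows any measurement.
  Giving up is decided by the sender of the last qubit so that this party can
  instead send \<open>0\<close> whenever it would give up, or negate the bit and then do the same.  Hence a
  protocol for \<open>f\<close> yields one-sided-error protocols of the same cost for \<open>f\<close> and \<open>\<not> f\<close>.
\<close>

fun outcome :: "('x, 'y) step \<Rightarrow> nat set \<Rightarrow> nat \<Rightarrow> nat \<Rightarrow> bool option" where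
  "outcome (AliceSends d U) G i j = (if i \<in> G then None else Some (odd j))"
| "outcome (BobSends d V) G i j = (if j \<in> G then None else Some (odd i))"

definition outcome_prob ::
    "complex mat \<Rightarrow> ('x, 'y) step list \<Rightarrow> nat set \<Rightarrow> 'x \<Rightarrow> 'y \<Rightarrow> bool option \<Rightarrow> real" where
  "outcome_prob \<Psi> ss G x y r =
     (let \<Phi> = run ss x y \<Psi> in
        \<Sum>(i, j) \<in> {(i, j). i < dim_row \<Phi> \<and> j < dim_col \<Phi> \<and> outcome (last ss) G i j = r}.
          (cmod (\<Phi> $$ (i, j)))\<^sup>2)"

definition las_vegas ::
    "'x set \<Rightarrow> 'y set \<Rightarrow> ('x \<Rightarrow> 'y \<Rightarrow> bool) \<Rightarrow>
     nat \<Rightarrow> nat \<Rightarrow> complex mat \<Rightarrow> ('x, 'y) step list \<Rightarrow> nat set \<Rightarrow> bool" where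
  "las_vegas X Y f a b \<Psi> ss G \<longleftrightarrow>
     unit_state a b \<Psi> \<and> ss \<noteq> [] \<and> valid_steps X Y a b ss \<and>
     (\<forall>x\<in>X. \<forall>y\<in>Y. outcome_prob \<Psi> ss G x y (Some (\<not> f x y)) = 0 \<and>
                   outcome_prob \<Psi> ss G x y None \<le> 1 / 2)"

definition Q0 :: "'x set \<Rightarrow> 'y set \<Rightarrow> ('x \<Rightarrow> 'y \<Rightarrow> bool) \<Rightarrow> nat" where
  "Q0 X Y f = (LEAST q. \<exists>a b \<Psi> ss G. las_vegas X Y f a b \<Psi> ss G \<and> length ss = q)"

end

(*
  Expanding every transmitted qubit in the computational basis turns a run with q qubits into
  \<Sum>\<^sub>c A\<^sub>c(x) \<Psi> B\<^sub>c(y)\<^sup>T over the 2^q bit strings c.  This is one product operator A(x) \<otimes> B(y) applied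
  to \<psi> = \<Sum>\<^sub>c |c>|c> \<otimes> \<Psi>, of squared norm 2^q, and the squared operator norms of A(x) and B(y) have
  product at most 2^q.

  Suppose A\<^sub>k \<psi> B\<^sub>l\<^sup>T = 0 whenever k \<noteq> l.  Projecting \<psi> onto the orthogonal complement of the column
  space of \<psi> B\<^sub>k\<^sup>T changes no other amplitude, so the squared norms of the A\<^sub>k \<psi> B\<^sub>k\<^sup>T are paid for by
  orthogonal parts of \<psi>, and their sum is at most 2^q * 2^q.  A fooling set only gives this for (k, l)
  or for (l, k); running two copies of the protocol with the parties exchanged in the second one
  repairs this and squares the bound.  As each accepting probability is at least 1/2, a fooling set
  F satisfies card F / 4 \<le> 2^(4 q).
*)
theory Submission
  imports Defs
begin

section \<open>Amplitudes of product operators\<close>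

definition sq_norm_on :: "'i set \<Rightarrow> ('i \<Rightarrow> complex) \<Rightarrow> real" where
  "sq_norm_on I v = (\<Sum>i\<in>I. (cmod (v i))\<^sup>2)"

text \<open>\<open>K\<close> bounds the squared operator norm. Matrices are functions on arbitrary
  index sets, so that tensor products need no re-encoding of indices.\<close>

definition sq_bounded :: "real \<Rightarrow> 'r set \<Rightarrow> 'i set \<Rightarrow> ('r \<Rightarrow> 'i \<Rightarrow> complex) \<Rightarrow> bool" where
  "sq_bounded K R I A \<longleftrightarrow> 0 \<le> K \<and>
     (\<forall>v. sq_norm_on R (\<lambda>r. \<Sum>i\<in>I. A r i * v i) \<le> K * sq_norm_on I v)"

definition amplitude ::
    "'i set \<Rightarrow> 'j set \<Rightarrow> ('r \<Rightarrow> 'i \<Rightarrow> complex) \<Rightarrow> ('i \<Rightarrow> 'j \<Rightarrow> complex) \<Rightarrow>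
     ('s \<Rightarrow> 'j \<Rightarrow> complex) \<Rightarrow> 'r \<Rightarrow> 's \<Rightarrow> complex" where
  "amplitude I J A \<psi> B r s = (\<Sum>i\<in>I. \<Sum>j\<in>J. A r i * \<psi> i j * B s j)"

text \<open>The operators act on different sides: bound \<open>A\<close> on each column of
  \<open>\<psi> B\<^sup>T\<close>, then \<open>B\<close> on each row of
  \<open>\<psi>\<close>.\<close>

lemma amplitude_sq_bound:
  assumes "sq_bounded KA R I A" "sq_bounded KB S J B"
  shows "(\<Sum>r\<in>R. \<Sum>s\<in>S. (cmod (amplitude I J A \<psi> B r s))\<^sup>2)
         \<le> KA * KB * (\<Sum>i\<in>I. \<Sum>j\<in>J. (cmod (\<psi> i j))\<^sup>2)"
proof -
  have A: "(\<Sum>r\<in>R. (cmod (\<Sum>i\<in>I. A r i * v i))\<^sup>2) \<le> KA * (\<Sum>i\<in>I. (cmod (v i))\<^sup>2)" for v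
    using assms(1) unfolding sq_bounded_def sq_norm_on_def by blast
  have B: "(\<Sum>s\<in>S. (cmod (\<Sum>j\<in>J. B s j * v j))\<^sup>2) \<le> KB * (\<Sum>j\<in>J. (cmod (v j))\<^sup>2)" for v
    using assms(2) unfolding sq_bounded_def sq_norm_on_def by blast
  have KA: "0 \<le> KA"
    using assms(1) by (simp add: sq_bounded_def)
  have "(\<Sum>r\<in>R. \<Sum>s\<in>S. (cmod (amplitude I J A \<psi> B r s))\<^sup>2)
      = (\<Sum>s\<in>S. \<Sum>r\<in>R. (cmod (\<Sum>i\<in>I. A r i * (\<Sum>j\<in>J. B s j * \<psi> i j)))\<^sup>2)"
    unfolding amplitude_def by (subst sum.swap) (simp add: sum_distrib_left mult_ac)
  also have "\<dots> \<le> (\<Sum>s\<in>S. KA * (\<Sum>i\<in>I. (cmod (\<Sum>j\<in>J. B s j * \<psi> i j))\<^sup>2))"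
    by (intro sum_mono A)
  also have "\<dots> = KA * (\<Sum>i\<in>I. \<Sum>s\<in>S. (cmod (\<Sum>j\<in>J. B s j * \<psi> i j))\<^sup>2)"
    by (subst sum.swap) (simp add: sum_distrib_left)
  also have "\<dots> \<le> KA * (\<Sum>i\<in>I. KB * (\<Sum>j\<in>J. (cmod (\<psi> i j))\<^sup>2))"
    by (intro mult_left_mono sum_mono B KA)
  finally show ?thesis
    by (simp add: sum_distrib_left mult_ac)
qed

lemma sq_bounded_mono:
  assumes "sq_bounded K R I A" "R' \<subseteq> R" "finite R"
  shows "sq_bounded K R' I A"
  unfolding sq_bounded_def
proof (intro conjI allI)
  show "0 \<le> K"
    using assms(1) by (simp add: sq_bounded_def)
  fix v
  have "sq_norm_on R' (\<lambda>r. \<Sum>i\<in>I. A r i * v i) \<le> sq_norm_on R (\<lambda>r. \<Sum>i\<in>I. A r i * v i)"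
    unfolding sq_norm_on_def by (rule sum_mono2) (use assms in auto)
  also have "\<dots> \<le> K * sq_norm_on I v"
    using assms(1) by (simp add: sq_bounded_def)
  finally show "sq_norm_on R' (\<lambda>r. \<Sum>i\<in>I. A r i * v i) \<le> K * sq_norm_on I v" .
qed

text \<open>A vector on \<open>I \<times> J\<close> is read as a matrix; the tensor product then
  acts on it as \<open>amplitude\<close> does.\<close>

lemma sq_bounded_tensor:
  assumes "sq_bounded KA R I A" "sq_bounded KB S J B"
  shows "sq_bounded (KA * KB) (R \<times> S) (I \<times> J) (\<lambda>(r, s) (i, j). A r i * B s j)"
  unfolding sq_bounded_def
proof (intro conjI allI)
  show "0 \<le> KA * KB"
    using assms by (simp add: sq_bounded_def)
  fix v
  show "sq_norm_on (R \<times> S) (\<lambda>p. \<Sum>q\<in>I \<times> J. (case p of (r, s) \<Rightarrow> \<lambda>(i, j). A r i * B s j) q * v q)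
      \<le> KA * KB * sq_norm_on (I \<times> J) v"
    using amplitude_sq_bound[OF assms, of "\<lambda>i j. v (i, j)"]
    unfolding sq_norm_on_def amplitude_def
    by (simp add: sum.cartesian_product' mult_ac)
qed

section \<open>Splitting a state along a column space\<close>

text \<open>\<open>\<chi>\<close> is the projection of the columns of \<open>\<psi>\<close> onto the column space of \<open>\<psi> B\<^sup>T\<close>.\<close>

lemma column_space_decomposition:
  fixes \<psi> :: "'i \<Rightarrow> 'j \<Rightarrow> complex"
  assumes "finite S" "finite I"
  shows "\<exists>\<phi> \<chi>. (\<forall>i j. \<psi> i j = \<phi> i j + \<chi> i j) \<and>
     (\<forall>j l. (\<Sum>i\<in>I. cnj (\<chi> i j) * \<phi> i l) = 0) \<and>
     (\<forall>s\<in>S. \<forall>i\<in>I. (\<Sum>j\<in>J. \<phi> i j * B s j) = 0) \<and>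
     (\<forall>a. (\<forall>s\<in>S. (\<Sum>i\<in>I. \<Sum>j\<in>J. a i * \<psi> i j * B s j) = 0) \<longrightarrow>
          (\<forall>j. (\<Sum>i\<in>I. a i * \<chi> i j) = 0))"
  using assms(1)
\<comment> \<open>Gram-Schmidt over the columns of \<open>\<psi> B\<^sup>T\<close>, one for each
  \<open>s\<close>. That \<open>\<chi>\<close> lies in their span is expressed dually: a functional
  \<open>a\<close> vanishing on all of them vanishes on \<open>\<chi>\<close>.\<close>
proof (induction S rule: finite_induct)
  case empty
  show ?case
    by (rule exI[of _ \<psi>], rule exI[of _ "\<lambda>i j. 0"]) simp
next
  case (insert s S)
  obtain \<phi> \<chi> where
    sum: "\<And>i j. \<psi> i j = \<phi> i j + \<chi> i j" and
    orth: "\<And>j l. (\<Sum>i\<in>I. cnj (\<chi> i j) * \<phi> i l) = 0" and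
    kill: "\<And>s i. s \<in> S \<Longrightarrow> i \<in> I \<Longrightarrow> (\<Sum>j\<in>J. \<phi> i j * B s j) = 0" and
    ann: "\<And>a j. (\<And>s. s \<in> S \<Longrightarrow> (\<Sum>i\<in>I. \<Sum>j\<in>J. a i * \<psi> i j * B s j) = 0) \<Longrightarrow>
                 (\<Sum>i\<in>I. a i * \<chi> i j) = 0"
    using insert.IH by (elim exE conjE) blast
  \<comment> \<open>\<open>w\<close> is the component of the new column orthogonal to
    \<open>\<chi>\<close>, \<open>W\<close> its squared norm, and \<open>\<alpha> j\<close> the
    inner product of \<open>w\<close> with column \<open>j\<close> of \<open>\<phi>\<close>.\<close>
  define w where "w i = (\<Sum>j\<in>J. \<phi> i j * B s j)" for i
  define W where "W = (\<Sum>i\<in>I. cnj (w i) * w i)"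
  define \<alpha> where "\<alpha> j = (\<Sum>i\<in>I. cnj (w i) * \<phi> i j)" for j
  have W: "W = of_real (\<Sum>i\<in>I. (cmod (w i))\<^sup>2)"
    unfolding W_def of_real_sum complex_norm_square by (simp add: mult.commute)
  have w_orth: "(\<Sum>i\<in>I. cnj (\<chi> i j) * w i) = 0" for j
  proof -
    have "(\<Sum>i\<in>I. cnj (\<chi> i j) * w i) = (\<Sum>l\<in>J. (\<Sum>i\<in>I. cnj (\<chi> i j) * \<phi> i l) * B s l)"
      unfolding w_def sum_distrib_left sum_distrib_right by (subst sum.swap) (simp add: mult_ac)
    thus ?thesis
      by (simp add: orth)
  qed
  \<comment> \<open>\<open>a\<close> vanishes on the new column and, by induction, on the part of it
    that comes from \<open>\<chi>\<close>; the difference is \<open>w\<close>.\<close>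
  have a_w: "(\<Sum>i\<in>I. a i * w i) = 0"
    if "\<forall>s'\<in>insert s S. (\<Sum>i\<in>I. \<Sum>j\<in>J. a i * \<psi> i j * B s' j) = 0" for a
  proof -
    have "(\<Sum>i\<in>I. a i * \<chi> i j) = 0" for j
      by (rule ann) (use that in auto)
    hence "(\<Sum>j\<in>J. (\<Sum>i\<in>I. a i * \<chi> i j) * B s j) = 0"
      by simp
    hence 0: "(\<Sum>i\<in>I. \<Sum>j\<in>J. a i * \<chi> i j * B s j) = 0"
      by (subst sum.swap) (simp add: sum_distrib_right)
    have "(\<Sum>i\<in>I. \<Sum>j\<in>J. a i * \<psi> i j * B s j)
       = (\<Sum>i\<in>I. a i * w i) + (\<Sum>i\<in>I. \<Sum>j\<in>J. a i * \<chi> i j * B s j)"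
      unfolding w_def sum sum_distrib_left sum.distrib[symmetric]
      by (intro sum.cong refl) (simp add: algebra_simps)
    with 0 that show ?thesis
      by simp
  qed
  show ?case
  proof (cases "W = 0")
    \<comment> \<open>Now \<open>w\<close> vanishes on \<open>I\<close>, so the old decomposition
      already serves \<open>s\<close>.\<close>
    case True
    hence "(\<Sum>i\<in>I. (cmod (w i))\<^sup>2) = 0"
      unfolding W by (simp only: of_real_eq_0_iff)
    hence "w i = 0" if "i \<in> I" for i
      using that assms(2) by (simp add: sum_nonneg_eq_0_iff)
    thus ?thesis
      using sum orth kill ann
      by (intro exI[of _ \<phi>] exI[of _ \<chi>]) (auto simp: w_def)
  next
    case False
    have Wc: "cnj W = W"
      using W by simp
    have \<alpha>c: "(\<Sum>i\<in>I. cnj (\<chi>' i) * w i) = cnj (\<Sum>i\<in>I. cnj (w i) * \<chi>' i)" for \<chi>'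
      by (simp add: mult.commute)
    \<comment> \<open>The projection of each column of \<open>\<phi>\<close> onto \<open>w\<close>
      is moved over to \<open>\<chi>\<close>.\<close>
    define \<phi>' where "\<phi>' i j = \<phi> i j - w i * (\<alpha> j / W)" for i j
    define \<chi>' where "\<chi>' i j = \<chi> i j + w i * (\<alpha> j / W)" for i j
    have w_orth': "(\<Sum>i\<in>I. cnj (w i) * \<phi>' i l) = 0" for l
    proof -
      have "(\<Sum>i\<in>I. cnj (w i) * \<phi>' i l) = \<alpha> l - (\<Sum>i\<in>I. (cnj (w i) * w i) * (\<alpha> l / W))"
        unfolding \<phi>'_def \<alpha>_def by (simp add: right_diff_distrib sum_subtractf mult_ac)
      also have "\<dots> = \<alpha> l - W * (\<alpha> l / W)"
        unfolding W_def by (simp only: sum_distrib_right)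
      finally show ?thesis
        using False by simp
    qed
    have 2: "(\<Sum>i\<in>I. cnj (\<chi>' i j) * \<phi>' i l) = 0" for j l
    proof -
      have "(\<Sum>i\<in>I. cnj (\<chi>' i j) * \<phi>' i l)
         = (\<Sum>i\<in>I. cnj (\<chi> i j) * \<phi> i l) - (\<Sum>i\<in>I. cnj (\<chi> i j) * w i) * (\<alpha> l / W)
           + cnj (\<alpha> j / W) * (\<Sum>i\<in>I. cnj (w i) * \<phi>' i l)"
        unfolding \<chi>'_def \<phi>'_def sum_distrib_left sum_distrib_right
          sum.distrib[symmetric] sum_subtractf[symmetric]
        by (intro sum.cong) (simp_all add: algebra_simps)
      thus ?thesis
        using orth w_orth w_orth' by simp
    qed
    have 3: "(\<Sum>j\<in>J. \<phi>' i j * B s' j) = 0" if "s' \<in> insert s S" "i \<in> I" for s' i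
    proof -
      have \<alpha>B: "(\<Sum>j\<in>J. \<alpha> j * B s' j) = (\<Sum>i\<in>I. cnj (w i) * (\<Sum>j\<in>J. \<phi> i j * B s' j))"
        unfolding \<alpha>_def sum_distrib_left sum_distrib_right by (subst sum.swap) (simp add: mult_ac)
      have "(\<Sum>j\<in>J. \<phi>' i j * B s' j)
          = (\<Sum>j\<in>J. \<phi> i j * B s' j) - w i / W * (\<Sum>j\<in>J. \<alpha> j * B s' j)"
        unfolding \<phi>'_def sum_distrib_left sum_subtractf[symmetric]
        by (intro sum.cong) (simp_all add: algebra_simps)
      also have "\<dots> = 0"
      \<comment> \<open>For \<open>s' = s\<close> the sum with \<open>\<alpha>\<close> is
        \<open>W\<close> and the two terms cancel; for older \<open>s'\<close> both vanish because
        \<open>\<phi>\<close> is killed by \<open>B s'\<close>.\<close>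
      proof (cases "s' = s")
        case True
        thus ?thesis
          using False unfolding \<alpha>B by (simp add: w_def[symmetric] W_def[symmetric])
      next
        case False
        with that have "s' \<in> S" by simp
        thus ?thesis
          unfolding \<alpha>B using kill that by simp
      qed
      finally show ?thesis .
    qed
    have 4: "(\<Sum>i\<in>I. a i * \<chi>' i j) = 0"
      if *: "\<forall>s'\<in>insert s S. (\<Sum>i\<in>I. \<Sum>j\<in>J. a i * \<psi> i j * B s' j) = 0" for a j
    proof -
      have "(\<Sum>i\<in>I. a i * \<chi>' i j) = (\<Sum>i\<in>I. a i * \<chi> i j) + (\<Sum>i\<in>I. a i * w i) * (\<alpha> j / W)"
        unfolding \<chi>'_def sum_distrib_right sum.distrib[symmetric]
        by (intro sum.cong) (simp_all add: algebra_simps)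
      thus ?thesis
        using ann[of a j] * a_w[OF *] by simp
    qed
    show ?thesis
      by (rule exI[of _ \<phi>'], rule exI[of _ \<chi>'])
         (use 2 3 4 sum in \<open>auto simp: \<phi>'_def \<chi>'_def\<close>)
  qed
qed

text \<open>Pythagoras: the cross terms are the given inner product and its conjugate.\<close>

lemma orthogonal_sum_sq_norm:
  assumes "(\<Sum>i\<in>I. cnj (v i) * u i) = 0"
  shows "(\<Sum>i\<in>I. (cmod (u i + v i))\<^sup>2) = (\<Sum>i\<in>I. (cmod (u i))\<^sup>2) + (\<Sum>i\<in>I. (cmod (v i))\<^sup>2)"
proof -
  have "cnj (\<Sum>i\<in>I. cnj (v i) * u i) = 0"
    using assms by simp
  hence *: "(\<Sum>i\<in>I. v i * cnj (u i)) = 0"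
    by simp
  have "complex_of_real (\<Sum>i\<in>I. (cmod (u i + v i))\<^sup>2)
      = of_real (\<Sum>i\<in>I. (cmod (u i))\<^sup>2) + of_real (\<Sum>i\<in>I. (cmod (v i))\<^sup>2)
        + (\<Sum>i\<in>I. cnj (v i) * u i) + (\<Sum>i\<in>I. v i * cnj (u i))"
    unfolding of_real_sum complex_norm_square sum.distrib[symmetric]
    by (intro sum.cong refl) (simp add: algebra_simps)
  also have "\<dots> = complex_of_real ((\<Sum>i\<in>I. (cmod (u i))\<^sup>2) + (\<Sum>i\<in>I. (cmod (v i))\<^sup>2))"
    unfolding assms * by simp
  finally show ?thesis
    by (simp only: of_real_eq_iff)
qed

text \<open>Induction on \<open>F\<close> with varying \<open>\<psi>\<close>. Splitting
  \<open>\<psi>\<close> along the column space of \<open>\<psi> B\<^sub>k\<^sup>T\<close> leaves the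
  amplitudes of \<open>k\<close> to \<open>\<chi>\<close> and those of the other members to
  \<open>\<phi>\<close>, and the squared norms of the two parts add up. The sign of
  \<open>KA * KB\<close> settles the empty \<open>F\<close>, where no operator bound provides
  it.\<close>

lemma orthogonal_amplitudes_bound:
  fixes \<psi> :: "'i \<Rightarrow> 'j \<Rightarrow> complex"
  assumes "finite F" "finite I" "finite R" "finite S"
    and "\<And>k. k \<in> F \<Longrightarrow> sq_bounded KA R I (A k)"
    and "\<And>k. k \<in> F \<Longrightarrow> sq_bounded KB S J (B k)"
    and "\<And>k l r s. k \<in> F \<Longrightarrow> l \<in> F \<Longrightarrow> k \<noteq> l \<Longrightarrow> r \<in> R \<Longrightarrow> s \<in> S \<Longrightarrow>
           amplitude I J (A k) \<psi> (B l) r s = 0"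
    and "0 \<le> KA * KB"
  shows "(\<Sum>k\<in>F. \<Sum>r\<in>R. \<Sum>s\<in>S. (cmod (amplitude I J (A k) \<psi> (B k) r s))\<^sup>2)
         \<le> KA * KB * (\<Sum>i\<in>I. \<Sum>j\<in>J. (cmod (\<psi> i j))\<^sup>2)"
  using assms(1,5-7)
proof (induction F arbitrary: \<psi> rule: finite_induct)
  case empty
  show ?case
    using assms(8) by (auto intro!: mult_nonneg_nonneg[of "KA * KB"] sum_nonneg)
next
  case (insert k F)
  obtain \<phi> \<chi> where
    sum: "\<And>i j. \<psi> i j = \<phi> i j + \<chi> i j" and
    orth: "\<And>j l. (\<Sum>i\<in>I. cnj (\<chi> i j) * \<phi> i l) = 0" and
    kill: "\<And>s i. s \<in> S \<Longrightarrow> i \<in> I \<Longrightarrow> (\<Sum>j\<in>J. \<phi> i j * B k s j) = 0" and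
    ann: "\<And>a j. (\<And>s. s \<in> S \<Longrightarrow> (\<Sum>i\<in>I. \<Sum>j\<in>J. a i * \<psi> i j * B k s j) = 0) \<Longrightarrow>
                 (\<Sum>i\<in>I. a i * \<chi> i j) = 0"
    using column_space_decomposition[OF assms(4,2), where \<psi> = \<psi> and J = J and B = "B k"]
    by (elim exE conjE) blast
  have split: "amplitude I J A' \<psi> B' r s = amplitude I J A' \<phi> B' r s + amplitude I J A' \<chi> B' r s"
    for A' :: "'r \<Rightarrow> 'i \<Rightarrow> complex" and B' :: "'s \<Rightarrow> 'j \<Rightarrow> complex" and r s
    unfolding amplitude_def sum sum.distrib[symmetric]
    by (intro sum.cong refl) (simp add: algebra_simps)
  \<comment> \<open>\<open>A l\<close> annihilates \<open>\<psi> B\<^sub>k\<^sup>T\<close> and hence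
    \<open>\<chi>\<close>. With \<open>B'\<close> arbitrary, the vanishing hypotheses pass from
    \<open>\<psi>\<close> to \<open>\<phi>\<close>.\<close>
  have F: "amplitude I J (A l) \<psi> B' r s = amplitude I J (A l) \<phi> B' r s"
    if "l \<in> F" "r \<in> R" for l B' r s
  proof -
    have "(\<Sum>i\<in>I. A l r i * \<chi> i j) = 0" for j
    proof (rule ann)
      fix s assume "s \<in> S"
      thus "(\<Sum>i\<in>I. \<Sum>j\<in>J. A l r i * \<psi> i j * B k s j) = 0"
        using insert.prems(3)[of l k r s] insert.hyps(2) that unfolding amplitude_def by auto
    qed
    hence "(\<Sum>j\<in>J. (\<Sum>i\<in>I. A l r i * \<chi> i j) * B' s j) = 0"
      by simp
    hence "amplitude I J (A l) \<chi> B' r s = 0"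
      unfolding amplitude_def by (subst sum.swap) (simp add: sum_distrib_right)
    thus ?thesis
      by (simp add: split)
  qed
  have k: "amplitude I J (A k) \<psi> (B k) r s = amplitude I J (A k) \<chi> (B k) r s"
    if "r \<in> R" "s \<in> S" for r s
  proof -
    have "amplitude I J (A k) \<phi> (B k) r s = (\<Sum>i\<in>I. A k r i * (\<Sum>j\<in>J. \<phi> i j * B k s j))"
      unfolding amplitude_def by (simp add: sum_distrib_left mult_ac)
    thus ?thesis
      using kill that by (simp add: split)
  qed
  have norm: "(\<Sum>i\<in>I. \<Sum>j\<in>J. (cmod (\<psi> i j))\<^sup>2)
      = (\<Sum>i\<in>I. \<Sum>j\<in>J. (cmod (\<phi> i j))\<^sup>2) + (\<Sum>i\<in>I. \<Sum>j\<in>J. (cmod (\<chi> i j))\<^sup>2)"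
    by (subst (1 2 3) sum.swap)
       (simp add: sum orthogonal_sum_sq_norm[OF orth] sum.distrib)
  have IH: "(\<Sum>l\<in>F. \<Sum>r\<in>R. \<Sum>s\<in>S. (cmod (amplitude I J (A l) \<phi> (B l) r s))\<^sup>2)
         \<le> KA * KB * (\<Sum>i\<in>I. \<Sum>j\<in>J. (cmod (\<phi> i j))\<^sup>2)"
    by (rule insert.IH) (use insert.prems in \<open>auto simp flip: F\<close>)
  have "(\<Sum>r\<in>R. \<Sum>s\<in>S. (cmod (amplitude I J (A k) \<chi> (B k) r s))\<^sup>2)
      \<le> KA * KB * (\<Sum>i\<in>I. \<Sum>j\<in>J. (cmod (\<chi> i j))\<^sup>2)"
    by (rule amplitude_sq_bound) (use insert.prems in auto)
  with IH show ?case
    using insert.hyps by (simp add: F k norm distrib_left)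
qed

text \<open>The order of summation is that of pairs \<open>(r, s')\<close> and
  \<open>(s, r')\<close>, which index the two sides of a doubled system with exchanged
  parties.\<close>

lemma sum_product_interleaved:
  fixes f :: "'a \<Rightarrow> 'b \<Rightarrow> real"
  shows "(\<Sum>r\<in>R. \<Sum>s'\<in>S. \<Sum>s\<in>S. \<Sum>r'\<in>R. f r s * f r' s') = (\<Sum>r\<in>R. \<Sum>s\<in>S. f r s)\<^sup>2"
proof -
  have "(\<Sum>r\<in>R. \<Sum>s'\<in>S. \<Sum>s\<in>S. \<Sum>r'\<in>R. f r s * f r' s')
      = (\<Sum>r\<in>R. \<Sum>s\<in>S. \<Sum>s'\<in>S. \<Sum>r'\<in>R. f r s * f r' s')"
    by (intro sum.cong sum.swap refl)
  also have "\<dots> = (\<Sum>r\<in>R. \<Sum>s\<in>S. \<Sum>r'\<in>R. \<Sum>s'\<in>S. f r s * f r' s')"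
    by (intro sum.cong sum.swap refl)
  also have "\<dots> = (\<Sum>r\<in>R. \<Sum>s\<in>S. f r s * (\<Sum>r'\<in>R. \<Sum>s'\<in>S. f r' s'))"
    by (simp add: sum_distrib_left)
  finally show ?thesis
    by (simp add: power2_eq_square sum_distrib_right)
qed

text \<open>
  Two copies of \<open>\<psi>\<close>, with the roles of the parties exchanged in the second one, multiply the
  \<open>(k, l)\<close> amplitudes by the \<open>(l, k)\<close> amplitudes, so that the off-diagonal ones vanish.
\<close>

lemma fooling_amplitudes_bound:
  fixes \<psi> :: "'i \<Rightarrow> 'j \<Rightarrow> complex"
  assumes fin: "finite F" "finite I" "finite J" "finite R" "finite S"
    and A: "\<And>k. k \<in> F \<Longrightarrow> sq_bounded KA R I (A k)"
    and B: "\<And>k. k \<in> F \<Longrightarrow> sq_bounded KB S J (B k)"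
    and zero: "\<And>k l. k \<in> F \<Longrightarrow> l \<in> F \<Longrightarrow> k \<noteq> l \<Longrightarrow>
           (\<forall>r\<in>R. \<forall>s\<in>S. amplitude I J (A k) \<psi> (B l) r s = 0) \<or>
           (\<forall>r\<in>R. \<forall>s\<in>S. amplitude I J (A l) \<psi> (B k) r s = 0)"
    and K: "0 \<le> KA * KB"
  shows "(\<Sum>k\<in>F. (\<Sum>r\<in>R. \<Sum>s\<in>S. (cmod (amplitude I J (A k) \<psi> (B k) r s))\<^sup>2)\<^sup>2)
         \<le> (KA * KB * (\<Sum>i\<in>I. \<Sum>j\<in>J. (cmod (\<psi> i j))\<^sup>2))\<^sup>2"
proof -
  \<comment> \<open>Each side of the doubled system holds Alice's part of one copy and Bob's part of
    the other, so it applies both operators of its own index.\<close>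
  define A2 where "A2 k = (\<lambda>(r, s) (i, j). A k r i * B k s j)" for k
  define B2 where "B2 k = (\<lambda>(s, r) (j, i). B k s j * A k r i)" for k
  define \<psi>2 where "\<psi>2 = (\<lambda>(i, j') (j, i'). \<psi> i j * \<psi> i' j')"
  have amp: "amplitude (I \<times> J) (J \<times> I) (A2 k) \<psi>2 (B2 l) (r, s') (s, r')
      = amplitude I J (A k) \<psi> (B l) r s * amplitude I J (A l) \<psi> (B k) r' s'" for k l r s r' s'
  proof -
    have "amplitude (I \<times> J) (J \<times> I) (A2 k) \<psi>2 (B2 l) (r, s') (s, r')
       = (\<Sum>i\<in>I. \<Sum>j'\<in>J. \<Sum>j\<in>J. \<Sum>i'\<in>I.
            (A k r i * \<psi> i j * B l s j) * (A l r' i' * \<psi> i' j' * B k s' j'))"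
      unfolding amplitude_def A2_def B2_def \<psi>2_def
      by (simp add: sum.cartesian_product' mult_ac)
    also have "\<dots> = (\<Sum>i\<in>I. \<Sum>j\<in>J. \<Sum>j'\<in>J. \<Sum>i'\<in>I.
            (A k r i * \<psi> i j * B l s j) * (A l r' i' * \<psi> i' j' * B k s' j'))"
      by (intro sum.cong sum.swap refl)
    also have "\<dots> = (\<Sum>i\<in>I. \<Sum>j\<in>J. \<Sum>i'\<in>I. \<Sum>j'\<in>J.
            (A k r i * \<psi> i j * B l s j) * (A l r' i' * \<psi> i' j' * B k s' j'))"
      by (intro sum.cong sum.swap refl)
    also have "\<dots> = (\<Sum>i\<in>I. \<Sum>j\<in>J. A k r i * \<psi> i j * B l s j * amplitude I J (A l) \<psi> (B k) r' s')"
      unfolding amplitude_def by (simp add: sum_distrib_left)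
    finally show ?thesis
      by (simp add: amplitude_def[of I J "A k"] sum_distrib_right)
  qed
  have "(\<Sum>k\<in>F. \<Sum>p\<in>R \<times> S. \<Sum>q\<in>S \<times> R.
           (cmod (amplitude (I \<times> J) (J \<times> I) (A2 k) \<psi>2 (B2 k) p q))\<^sup>2)
      \<le> (KA * KB) * (KB * KA) * (\<Sum>p\<in>I \<times> J. \<Sum>q\<in>J \<times> I. (cmod (\<psi>2 p q))\<^sup>2)"
  proof (rule orthogonal_amplitudes_bound)
    show "sq_bounded (KA * KB) (R \<times> S) (I \<times> J) (A2 k)" if "k \<in> F" for k
      unfolding A2_def by (intro sq_bounded_tensor A B that)
    show "sq_bounded (KB * KA) (S \<times> R) (J \<times> I) (B2 k)" if "k \<in> F" for k
      unfolding B2_def by (intro sq_bounded_tensor A B that)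
    show "amplitude (I \<times> J) (J \<times> I) (A2 k) \<psi>2 (B2 l) p q = 0"
      if "k \<in> F" "l \<in> F" "k \<noteq> l" "p \<in> R \<times> S" "q \<in> S \<times> R" for k l p q
      using zero[of k l] that by (auto simp: amp)
    show "0 \<le> KA * KB * (KB * KA)"
      using K by (simp add: mult.commute)
  qed (use fin in auto)
  moreover have "(\<Sum>p\<in>R \<times> S. \<Sum>q\<in>S \<times> R.
           (cmod (amplitude (I \<times> J) (J \<times> I) (A2 k) \<psi>2 (B2 k) p q))\<^sup>2)
      = (\<Sum>r\<in>R. \<Sum>s\<in>S. (cmod (amplitude I J (A k) \<psi> (B k) r s))\<^sup>2)\<^sup>2" for k
    by (simp add: sum.cartesian_product' amp norm_mult power_mult_distrib sum_product_interleaved)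
  moreover have "(\<Sum>p\<in>I \<times> J. \<Sum>q\<in>J \<times> I. (cmod (\<psi>2 p q))\<^sup>2)
      = (\<Sum>i\<in>I. \<Sum>j\<in>J. (cmod (\<psi> i j))\<^sup>2)\<^sup>2"
    by (simp add: \<psi>2_def sum.cartesian_product' norm_mult power_mult_distrib sum_product_interleaved)
  ultimately show ?thesis
    by (simp add: power2_eq_square mult_ac)
qed

section \<open>The local operators of a protocol\<close>

text \<open>Splits off the lowest bit of an index, which is where the encoding keeps a transmitted
  qubit.\<close>

lemma sum_lessThan_double:
  fixes f :: "nat \<Rightarrow> 'a :: comm_monoid_add"
  shows "(\<Sum>k<2 * n. f k) = (\<Sum>k<n. f (2 * k) + f (2 * k + 1))"
  by (induction n) (simp_all add: add_ac)

text \<open>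
  A run is seen by one party as a list of steps \<open>Some (d, U)\<close>, in which it applies \<open>U\<close> and sends a
  qubit, and \<open>None\<close>, in which it receives a qubit.  For every possible sequence \<open>c\<close> of values of
  the transmitted qubits, \<open>local_op\<close> is the resulting operator on the register of that party;
  the least significant bit of \<open>c\<close> belongs to the first qubit.
\<close>

type_synonym 'z view = "(nat \<times> ('z \<Rightarrow> complex mat)) option list"

fun local_op :: "'z view \<Rightarrow> 'z \<Rightarrow> nat \<Rightarrow> nat \<Rightarrow> nat \<Rightarrow> complex" where
  "local_op [] z c r i = of_bool (r = i)"
| "local_op (Some (d, U) # vs) z c r i =
     (\<Sum>k<d. local_op vs z (c div 2) r k * U z $$ (2 * k + c mod 2, i))"
| "local_op (None # vs) z c r i = local_op vs z (c div 2) r (2 * i + c mod 2)"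

fun local_dim :: "'z view \<Rightarrow> nat \<Rightarrow> nat" where
  "local_dim [] n = n"
| "local_dim (Some (d, U) # vs) n = local_dim vs d"
| "local_dim (None # vs) n = local_dim vs (2 * n)"

fun local_valid :: "'z view \<Rightarrow> 'z \<Rightarrow> nat \<Rightarrow> bool" where
  "local_valid [] z n \<longleftrightarrow> True"
| "local_valid (Some (d, U) # vs) z n \<longleftrightarrow> isometry (2 * d) n (U z) \<and> local_valid vs z d"
| "local_valid (None # vs) z n \<longleftrightarrow> local_valid vs z (2 * n)"

fun sends :: "'z view \<Rightarrow> nat" where
  "sends [] = 0"
| "sends (Some p # vs) = Suc (sends vs)"
| "sends (None # vs) = sends vs"

fun alice_view :: "('x, 'y) step list \<Rightarrow> 'x view" where
  "alice_view [] = []"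
| "alice_view (AliceSends d U # ss) = Some (d, U) # alice_view ss"
| "alice_view (BobSends d V # ss) = None # alice_view ss"

fun bob_view :: "('x, 'y) step list \<Rightarrow> 'y view" where
  "bob_view [] = []"
| "bob_view (AliceSends d U # ss) = None # bob_view ss"
| "bob_view (BobSends d V # ss) = Some (d, V) # bob_view ss"

lemma length_alice_view [simp]: "length (alice_view ss) = length ss"
  by (induction ss rule: alice_view.induct) auto

lemma length_bob_view [simp]: "length (bob_view ss) = length ss"
  by (induction ss rule: bob_view.induct) auto

text \<open>Every qubit has exactly one sender, so the two bounds \<open>2 ^ sends\<close> multiply
  to \<open>2 ^ length ss\<close>.\<close>

lemma sends_views: "sends (alice_view ss) + sends (bob_view ss) = length ss"
  by (induction ss rule: bob_view.induct) auto

lemma local_valid_alice_view: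
  "valid_steps X Y a b ss \<Longrightarrow> x \<in> X \<Longrightarrow> local_valid (alice_view ss) x a"
  by (induction X Y a b ss rule: valid_steps.induct) auto

lemma local_valid_bob_view:
  "valid_steps X Y a b ss \<Longrightarrow> y \<in> Y \<Longrightarrow> local_valid (bob_view ss) y b"
  by (induction X Y a b ss rule: valid_steps.induct) auto

section \<open>Norm bounds for local operators\<close>

lemma mat_adjoint_mult_entry:
  assumes "U \<in> carrier_mat m n" "i < n" "j < n"
  shows "(mat_adjoint U * U) $$ (i, j) = (\<Sum>r<m. cnj (U $$ (r, i)) * U $$ (r, j))"
  using assms
  by (auto simp: mat_adjoint_def scalar_prod_def mat_of_rows_index atLeast0LessThan intro!: sum.cong)

text \<open>Expanding the squares and summing over \<open>r\<close> first leaves the inner products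
  of the columns of \<open>U\<close>, which are orthonormal.\<close>

lemma isometry_sq_norm:
  assumes "isometry m n U"
  shows "(\<Sum>r<m. (cmod (\<Sum>i<n. U $$ (r, i) * v i))\<^sup>2) = (\<Sum>i<n. (cmod (v i))\<^sup>2)"
proof -
  have U: "U \<in> carrier_mat m n" and adj: "mat_adjoint U * U = 1\<^sub>m n"
    using assms by (auto simp: isometry_def)
  have orth: "(\<Sum>r<m. cnj (U $$ (r, i)) * U $$ (r, j)) = of_bool (i = j)"
    if "i < n" "j < n" for i j
    using that unfolding mat_adjoint_mult_entry[OF U that, symmetric] adj by simp
  have "complex_of_real (\<Sum>r<m. (cmod (\<Sum>i<n. U $$ (r, i) * v i))\<^sup>2)
      = (\<Sum>r<m. \<Sum>j<n. \<Sum>i<n. (U $$ (r, j) * v j) * cnj (U $$ (r, i) * v i))"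
    unfolding of_real_sum complex_norm_square by (simp add: sum_product)
  also have "\<dots> = (\<Sum>j<n. \<Sum>i<n. \<Sum>r<m. (U $$ (r, j) * v j) * cnj (U $$ (r, i) * v i))"
    by (rule trans[OF sum.swap], rule sum.cong[OF refl], rule sum.swap)
  also have "\<dots> = (\<Sum>j<n. \<Sum>i<n. (v j * cnj (v i)) * (\<Sum>r<m. cnj (U $$ (r, i)) * U $$ (r, j)))"
    by (simp add: sum_distrib_left mult_ac)
  also have "\<dots> = (\<Sum>j<n. \<Sum>i<n. if i = j then v j * cnj (v i) else 0)"
    by (intro sum.cong refl) (simp add: orth)
  also have "\<dots> = complex_of_real (\<Sum>i<n. (cmod (v i))\<^sup>2)"
    unfolding of_real_sum complex_norm_square by simp
  finally show ?thesis
    by (simp only: of_real_eq_iff)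
qed

lemma cmod_add_sq_le: "(cmod (u + v))\<^sup>2 \<le> 2 * ((cmod u)\<^sup>2 + (cmod v)\<^sup>2)"
proof -
  have "(cmod (u + v))\<^sup>2 \<le> (cmod u + cmod v)\<^sup>2"
    by (intro power_mono norm_triangle_ineq) auto
  also have "\<dots> \<le> 2 * ((cmod u)\<^sup>2 + (cmod v)\<^sup>2)"
    using sum_squares_bound[of "cmod u" "cmod v"] by (simp add: power2_sum)
  finally show ?thesis .
qed

text \<open>
  Sending a qubit costs a factor \<open>2\<close>: the two blocks \<open>U\<^sub>0\<close>, \<open>U\<^sub>1\<close> of the isometry are placed
  side by side, whereas they are stacked in \<open>U\<close> itself.
\<close>

lemma local_op_sq_bound:
  assumes "local_valid vs z n"
  shows "(\<Sum>r<local_dim vs n. (cmod (\<Sum>c<2 ^ length vs. \<Sum>i<n. local_op vs z c r i * v c i))\<^sup>2)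
         \<le> 2 ^ sends vs * (\<Sum>c<2 ^ length vs. \<Sum>i<n. (cmod (v c i))\<^sup>2)"
  using assms
proof (induction vs z n arbitrary: v rule: local_valid.induct)
  case (1 z n)
  have "(\<Sum>i<n. of_bool (r = i) * v 0 i) = v 0 r" if "r < n" for r
    using that by (simp add: of_bool_def if_distrib[of "\<lambda>x. x * _"] cong: if_cong)
  thus ?case
    by simp
next
  case (2 d U vs z n)
  \<comment> \<open>The strings \<open>2 * c\<close> and \<open>2 * c + 1\<close> differ only in the
    first qubit; their vectors meet the even and the odd rows of \<open>U z\<close> and are
    added.\<close>
  define w where
    "w c k = (\<Sum>i<n. U z $$ (2 * k, i) * v (2 * c) i)
           + (\<Sum>i<n. U z $$ (2 * k + 1, i) * v (2 * c + 1) i)" for c k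
  have U: "isometry (2 * d) n (U z)"
    using 2 by simp
  have eq: "(\<Sum>c<2 ^ length (Some (d, U) # vs). \<Sum>i<n. local_op (Some (d, U) # vs) z c r i * v c i)
      = (\<Sum>c<2 ^ length vs. \<Sum>k<d. local_op vs z c r k * w c k)" for r
  proof -
    have swap: "(\<Sum>i<n. (\<Sum>k<d. g k * h k i) * v' i) = (\<Sum>k<d. g k * (\<Sum>i<n. h k i * v' i))"
      for g v' :: "nat \<Rightarrow> complex" and h
      unfolding sum_distrib_left sum_distrib_right by (subst sum.swap) (simp add: mult_ac)
    show ?thesis
      by (simp add: sum_lessThan_double swap w_def distrib_left sum.distrib)
  qed
  have w: "(\<Sum>k<d. (cmod (w c k))\<^sup>2)
      \<le> 2 * ((\<Sum>i<n. (cmod (v (2 * c) i))\<^sup>2) + (\<Sum>i<n. (cmod (v (2 * c + 1) i))\<^sup>2))" for c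
  proof -
    have "(\<Sum>k<d. (cmod (w c k))\<^sup>2)
        \<le> (\<Sum>k<d. 2 * ((cmod (\<Sum>i<n. U z $$ (2 * k, i) * v (2 * c) i))\<^sup>2
                    + (cmod (\<Sum>i<n. U z $$ (2 * k + 1, i) * v (2 * c + 1) i))\<^sup>2))"
      unfolding w_def by (intro sum_mono cmod_add_sq_le)
    \<comment> \<open>Each block is enlarged to all rows of \<open>U z\<close>, which preserve the
      norm.\<close>
    also have "\<dots> \<le> 2 * ((\<Sum>k<2 * d. (cmod (\<Sum>i<n. U z $$ (k, i) * v (2 * c) i))\<^sup>2)
                    + (\<Sum>k<2 * d. (cmod (\<Sum>i<n. U z $$ (k, i) * v (2 * c + 1) i))\<^sup>2))"
      unfolding sum_lessThan_double sum_distrib_left[symmetric] sum.distrib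
      by (simp add: sum_nonneg)
    finally show ?thesis
      unfolding isometry_sq_norm[OF U] .
  qed
  have "(\<Sum>r<local_dim vs d. (cmod (\<Sum>c<2 ^ length vs. \<Sum>k<d. local_op vs z c r k * w c k))\<^sup>2)
      \<le> 2 ^ sends vs * (\<Sum>c<2 ^ length vs. \<Sum>k<d. (cmod (w c k))\<^sup>2)"
    using 2 by simp
  also have "\<dots> \<le> 2 ^ sends vs * (\<Sum>c<2 ^ length vs. 2 * ((\<Sum>i<n. (cmod (v (2 * c) i))\<^sup>2)
                    + (\<Sum>i<n. (cmod (v (2 * c + 1) i))\<^sup>2)))"
    by (intro mult_left_mono sum_mono w) simp
  also have "\<dots> = 2 ^ sends (Some (d, U) # vs) *
      (\<Sum>c<2 ^ length (Some (d, U) # vs). \<Sum>i<n. (cmod (v c i))\<^sup>2)"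
    by (simp add: sum_lessThan_double flip: sum_distrib_left)
  finally show ?case
    unfolding eq by simp
next
  case (3 vs z n)
  \<comment> \<open>Receiving only regroups indices: the lowest bit of \<open>c\<close> becomes the
    lowest bit of the register. No factor arises.\<close>
  have eq: "(\<Sum>c<2 ^ length (None # vs). \<Sum>i<n. local_op (None # vs) z c r i * v c i)
      = (\<Sum>c<2 ^ length vs. \<Sum>k<2 * n. local_op vs z c r k * v (2 * c + k mod 2) (k div 2))" for r
    by (simp add: sum_lessThan_double sum.distrib)
  have "(\<Sum>r<local_dim vs (2 * n). (cmod (\<Sum>c<2 ^ length vs. \<Sum>k<2 * n.
            local_op vs z c r k * v (2 * c + k mod 2) (k div 2)))\<^sup>2)
      \<le> 2 ^ sends vs * (\<Sum>c<2 ^ length vs. \<Sum>k<2 * n. (cmod (v (2 * c + k mod 2) (k div 2)))\<^sup>2)"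
    by (rule "3.IH") (use 3 in simp)
  thus ?case
    unfolding eq by (simp add: sum_lessThan_double sum.distrib)
qed

text \<open>The operators for all strings \<open>c\<close> are placed side by side as one operator
  with column index \<open>(c, i)\<close>.\<close>

lemma local_op_sq_bounded:
  assumes "local_valid vs z n"
  shows "sq_bounded (2 ^ sends vs) {..<local_dim vs n} ({..<2 ^ length vs} \<times> {..<n})
           (\<lambda>r (c, i). local_op vs z c r i)"
  unfolding sq_bounded_def sq_norm_on_def
  using local_op_sq_bound[OF assms, of "\<lambda>c i. v (c, i)" for v]
  by (simp add: sum.cartesian_product')

section \<open>The joint state along a run\<close>

lemma mult_mat_entry:
  assumes "A \<in> carrier_mat m n" "B \<in> carrier_mat n l" "i < m" "j < l"
  shows "(A * B) $$ (i, j) = (\<Sum>k<n. A $$ (i, k) * B $$ (k, j))"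
  using assms by (auto simp: scalar_prod_def atLeast0LessThan intro!: sum.cong)

text \<open>The isometry preserves the norm of every column, and passing the qubit merely permutes
  the entries.\<close>

lemma unit_state_alice_step:
  assumes "unit_state a b \<Psi>" "isometry (2 * d) a U"
  shows "unit_state d (2 * b) (qubit_to_Bob (U * \<Psi>))"
proof -
  have c: "\<Psi> \<in> carrier_mat a b" "U \<in> carrier_mat (2 * d) a"
    using assms by (auto simp: unit_state_def isometry_def)
  have "(\<Sum>i<d. \<Sum>j<2 * b. (cmod (qubit_to_Bob (U * \<Psi>) $$ (i, j)))\<^sup>2)
      = (\<Sum>i<d. \<Sum>j<2 * b. (cmod ((U * \<Psi>) $$ (2 * i + j mod 2, j div 2)))\<^sup>2)"
    using c by (intro sum.cong refl) (auto simp: qubit_to_Bob_def)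
  also have "\<dots> = (\<Sum>i<2 * d. \<Sum>j<b. (cmod ((U * \<Psi>) $$ (i, j)))\<^sup>2)"
    by (simp add: sum_lessThan_double sum.distrib)
  also have "\<dots> = (\<Sum>i<2 * d. \<Sum>j<b. (cmod (\<Sum>k<a. U $$ (i, k) * \<Psi> $$ (k, j)))\<^sup>2)"
    by (intro sum.cong refl) (simp add: mult_mat_entry[OF c(2,1)])
  also have "\<dots> = (\<Sum>j<b. \<Sum>k<a. (cmod (\<Psi> $$ (k, j)))\<^sup>2)"
    by (subst sum.swap) (simp add: isometry_sq_norm[OF assms(2)])
  also have "\<dots> = (\<Sum>k<a. \<Sum>j<b. (cmod (\<Psi> $$ (k, j)))\<^sup>2)"
    by (rule sum.swap)
  also have "\<dots> = 1"
    using assms(1) by (simp add: unit_state_def)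
  finally show ?thesis
    using c by (simp add: unit_state_def qubit_to_Bob_def)
qed

lemma unit_state_bob_step:
  assumes "unit_state a b \<Psi>" "isometry (2 * d) b V"
  shows "unit_state (2 * a) d (qubit_to_Alice (\<Psi> * transpose_mat V))"
proof -
  have c: "\<Psi> \<in> carrier_mat a b" "transpose_mat V \<in> carrier_mat b (2 * d)" "V \<in> carrier_mat (2 * d) b"
    using assms by (auto simp: unit_state_def isometry_def)
  have entry: "(\<Psi> * transpose_mat V) $$ (i, j) = (\<Sum>k<b. V $$ (j, k) * \<Psi> $$ (i, k))"
    if "i < a" "j < 2 * d" for i j
    unfolding mult_mat_entry[OF c(1,2) that] using c that by (auto intro!: sum.cong)
  have "(\<Sum>i<2 * a. \<Sum>j<d. (cmod (qubit_to_Alice (\<Psi> * transpose_mat V) $$ (i, j)))\<^sup>2)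
      = (\<Sum>i<2 * a. \<Sum>j<d. (cmod ((\<Psi> * transpose_mat V) $$ (i div 2, 2 * j + i mod 2)))\<^sup>2)"
    using c by (intro sum.cong refl) (auto simp: qubit_to_Alice_def)
  also have "\<dots> = (\<Sum>i<a. \<Sum>j<2 * d. (cmod ((\<Psi> * transpose_mat V) $$ (i, j)))\<^sup>2)"
    by (simp add: sum_lessThan_double sum.distrib)
  also have "\<dots> = (\<Sum>i<a. \<Sum>j<2 * d. (cmod (\<Sum>k<b. V $$ (j, k) * \<Psi> $$ (i, k)))\<^sup>2)"
    by (intro sum.cong refl arg_cong[of _ _ "\<lambda>z. (cmod z)\<^sup>2"] entry) auto
  also have "\<dots> = (\<Sum>i<a. \<Sum>k<b. (cmod (\<Psi> $$ (i, k)))\<^sup>2)"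
    by (simp add: isometry_sq_norm[OF assms(2)])
  also have "\<dots> = 1"
    using assms(1) by (simp add: unit_state_def)
  finally show ?thesis
    using c by (simp add: unit_state_def qubit_to_Alice_def)
qed

lemma unit_state_run:
  assumes "valid_steps X Y a b ss" "unit_state a b \<Psi>" "x \<in> X" "y \<in> Y"
  shows "unit_state (local_dim (alice_view ss) a) (local_dim (bob_view ss) b) (run ss x y \<Psi>)"
  using assms
  by (induction X Y a b ss arbitrary: \<Psi> rule: valid_steps.induct)
     (auto simp: unit_state_alice_step unit_state_bob_step)

text \<open>Summing over the basis values of every transmitted qubit separates the parties: once the
  string \<open>c\<close> is fixed, each side's operator depends on its own input only.\<close>

lemma run_entry:
  assumes "valid_steps X Y a b ss" "\<Psi> \<in> carrier_mat a b" "x \<in> X" "y \<in> Y"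
    and "r < local_dim (alice_view ss) a" "s < local_dim (bob_view ss) b"
  shows "run ss x y \<Psi> $$ (r, s) =
    (\<Sum>c<2 ^ length ss. \<Sum>i<a. \<Sum>j<b.
       local_op (alice_view ss) x c r i * \<Psi> $$ (i, j) * local_op (bob_view ss) y c s j)"
  using assms
proof (induction X Y a b ss arbitrary: \<Psi> rule: valid_steps.induct)
  case (1 X Y a b)
  thus ?case
    by (simp add: of_bool_def if_distrib[of "\<lambda>x. x * _"] if_distrib[of "\<lambda>x. _ * x"] cong: if_cong)
next
  case (2 X Y a b d U ss)
  have U: "U x \<in> carrier_mat (2 * d) a"
    using 2 by (auto simp: isometry_def)
  let ?A = "local_op (alice_view ss) x" and ?B = "local_op (bob_view ss) y"
  have "run (AliceSends d U # ss) x y \<Psi> $$ (r, s) =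
      (\<Sum>c<2 ^ length ss. \<Sum>i<d. \<Sum>j<2 * b.
         ?A c r i * qubit_to_Bob (U x * \<Psi>) $$ (i, j) * ?B c s j)"
    using 2 U by (simp add: qubit_to_Bob_def)
  also have "\<dots> = (\<Sum>c<2 ^ length ss. \<Sum>i<d. \<Sum>j<2 * b.
         ?A c r i * (\<Sum>k<a. U x $$ (2 * i + j mod 2, k) * \<Psi> $$ (k, j div 2)) * ?B c s j)"
    using "2.prems"(2) U
    by (intro sum.cong refl arg_cong2[of _ _ _ _ "(*)"])
       (auto simp: qubit_to_Bob_def mult_mat_entry[OF U "2.prems"(2)] simp del: index_mult_mat(1))
  \<comment> \<open>The sum over Alice's kept register goes innermost, where it composes
    \<open>U x\<close> with the rest of her operator.\<close>
  also have "\<dots> = (\<Sum>c<2 ^ length ss. \<Sum>j<2 * b. \<Sum>k<a.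
         (\<Sum>i<d. ?A c r i * U x $$ (2 * i + j mod 2, k)) * \<Psi> $$ (k, j div 2) * ?B c s j)"
  proof (rule sum.cong[OF refl])
    fix c
    have "(\<Sum>i<d. \<Sum>j<2 * b. ?A c r i * (\<Sum>k<a. U x $$ (2 * i + j mod 2, k) * \<Psi> $$ (k, j div 2)) * ?B c s j)
      = (\<Sum>j<2 * b. \<Sum>i<d. \<Sum>k<a. ?A c r i * U x $$ (2 * i + j mod 2, k) * \<Psi> $$ (k, j div 2) * ?B c s j)"
      by (subst sum.swap) (simp add: sum_distrib_left sum_distrib_right mult.assoc)
    also have "\<dots> = (\<Sum>j<2 * b. \<Sum>k<a. \<Sum>i<d. ?A c r i * U x $$ (2 * i + j mod 2, k) * \<Psi> $$ (k, j div 2) * ?B c s j)"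
      by (intro sum.cong refl sum.swap)
    finally show "(\<Sum>i<d. \<Sum>j<2 * b. ?A c r i * (\<Sum>k<a. U x $$ (2 * i + j mod 2, k) * \<Psi> $$ (k, j div 2)) * ?B c s j)
      = (\<Sum>j<2 * b. \<Sum>k<a. (\<Sum>i<d. ?A c r i * U x $$ (2 * i + j mod 2, k)) * \<Psi> $$ (k, j div 2) * ?B c s j)"
      by (simp add: sum_distrib_right)
  qed
  also have "\<dots> = (\<Sum>c<2 ^ length ss. \<Sum>k<a. \<Sum>j<2 * b.
         (\<Sum>i<d. ?A c r i * U x $$ (2 * i + j mod 2, k)) * \<Psi> $$ (k, j div 2) * ?B c s j)"
    by (intro sum.cong refl sum.swap)
  \<comment> \<open>The lowest bit of Bob's enlarged index is the qubit just sent; it becomes the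
    lowest bit of \<open>c\<close>.\<close>
  also have "\<dots> = (\<Sum>c<2 ^ length (AliceSends d U # ss). \<Sum>k<a. \<Sum>j<b.
       local_op (alice_view (AliceSends d U # ss)) x c r k * \<Psi> $$ (k, j)
       * local_op (bob_view (AliceSends d U # ss)) y c s j)"
    by (simp add: sum_lessThan_double sum.distrib)
  finally show ?case .
next
  case (3 X Y a b d V ss)
  have V: "V y \<in> carrier_mat (2 * d) b" and VT: "transpose_mat (V y) \<in> carrier_mat b (2 * d)"
    using 3 by (auto simp: isometry_def)
  let ?A = "local_op (alice_view ss) x" and ?B = "local_op (bob_view ss) y"
  have "run (BobSends d V # ss) x y \<Psi> $$ (r, s) =
      (\<Sum>c<2 ^ length ss. \<Sum>i<2 * a. \<Sum>j<d.
         ?A c r i * qubit_to_Alice (\<Psi> * transpose_mat (V y)) $$ (i, j) * ?B c s j)"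
    using 3 V by (simp add: qubit_to_Alice_def)
  also have "\<dots> = (\<Sum>c<2 ^ length ss. \<Sum>i<2 * a. \<Sum>j<d.
         ?A c r i * (\<Sum>k<b. \<Psi> $$ (i div 2, k) * V y $$ (2 * j + i mod 2, k)) * ?B c s j)"
    using "3.prems"(2) V
    by (intro sum.cong refl arg_cong2[of _ _ _ _ "(*)"])
       (auto simp: qubit_to_Alice_def mult_mat_entry[OF "3.prems"(2) VT] simp del: index_mult_mat(1) intro!: sum.cong)
  also have "\<dots> = (\<Sum>c<2 ^ length ss. \<Sum>i<2 * a. \<Sum>k<b.
         ?A c r i * \<Psi> $$ (i div 2, k) * (\<Sum>j<d. ?B c s j * V y $$ (2 * j + i mod 2, k)))"
  proof (rule sum.cong[OF refl], rule sum.cong[OF refl])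
    fix c i
    have "(\<Sum>j<d. ?A c r i * (\<Sum>k<b. \<Psi> $$ (i div 2, k) * V y $$ (2 * j + i mod 2, k)) * ?B c s j)
      = (\<Sum>k<b. \<Sum>j<d. ?A c r i * (\<Psi> $$ (i div 2, k) * V y $$ (2 * j + i mod 2, k)) * ?B c s j)"
      by (subst sum.swap) (simp add: sum_distrib_left sum_distrib_right)
    thus "(\<Sum>j<d. ?A c r i * (\<Sum>k<b. \<Psi> $$ (i div 2, k) * V y $$ (2 * j + i mod 2, k)) * ?B c s j)
      = (\<Sum>k<b. ?A c r i * \<Psi> $$ (i div 2, k) * (\<Sum>j<d. ?B c s j * V y $$ (2 * j + i mod 2, k)))"
      by (simp add: sum_distrib_left mult_ac)
  qed
  also have "\<dots> = (\<Sum>c<2 ^ length (BobSends d V # ss). \<Sum>k<a. \<Sum>j<b.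
       local_op (alice_view (BobSends d V # ss)) x c r k * \<Psi> $$ (k, j)
       * local_op (bob_view (BobSends d V # ss)) y c s j)"
    by (simp add: sum_lessThan_double sum.distrib)
  finally show ?case .
qed

section \<open>Las Vegas protocols and fooling sets\<close>

text \<open>The three outcomes partition the basis states of a unit vector.\<close>

lemma outcome_prob_total:
  assumes "unit_state m n (run ss x y \<Psi>)"
  shows "outcome_prob \<Psi> ss G x y None + outcome_prob \<Psi> ss G x y (Some True)
       + outcome_prob \<Psi> ss G x y (Some False) = 1"
proof -
  let ?\<Phi> = "run ss x y \<Psi>" and ?o = "\<lambda>(i, j). outcome (last ss) G i j"
  have c: "dim_row ?\<Phi> = m" "dim_col ?\<Phi> = n"
    using assms by (auto simp: unit_state_def)
  have prob: "outcome_prob \<Psi> ss G x y u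
      = (\<Sum>p\<in>{p \<in> {..<m} \<times> {..<n}. ?o p = u}. (cmod (?\<Phi> $$ p))\<^sup>2)" for u
    unfolding outcome_prob_def Let_def c by (intro sum.cong) auto
  have "(\<Sum>u\<in>{None, Some True, Some False}. outcome_prob \<Psi> ss G x y u)
      = (\<Sum>p\<in>{..<m} \<times> {..<n}. (cmod (?\<Phi> $$ p))\<^sup>2)"
    unfolding prob by (rule sum.group) auto
  also have "\<dots> = 1"
    using assms by (simp add: unit_state_def sum.cartesian_product')
  finally show ?thesis
    by (simp add: add.assoc)
qed

text \<open>With \<open>q\<close> qubits, the operators and the expanded state contribute
  \<open>2 ^ q\<close> each; squaring gives \<open>2 ^ (4 * q)\<close>. The remaining factor 4 comes
  from the squared probability 1/2.\<close>

lemma las_vegas_fooling_set_bound: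
  fixes X :: "'x set" and Y :: "'y set"
  assumes lv: "las_vegas X Y f a b \<Psi> ss G"
    and fs: "fooling_set X Y f v F" and fin: "finite F"
  shows "real (card F) \<le> 2 ^ (4 * length ss + 2)"
proof -
  define q where "q = length ss"
  define m where "m = local_dim (alice_view ss) a"
  define n where "n = local_dim (bob_view ss) b"
  have valid: "valid_steps X Y a b ss" and unit: "unit_state a b \<Psi>"
    and err: "\<And>x y. x \<in> X \<Longrightarrow> y \<in> Y \<Longrightarrow> outcome_prob \<Psi> ss G x y (Some (\<not> f x y)) = 0"
    and giveup: "\<And>x y. x \<in> X \<Longrightarrow> y \<in> Y \<Longrightarrow> outcome_prob \<Psi> ss G x y None \<le> 1 / 2"
    using lv by (auto simp: las_vegas_def)
  have \<Psi>: "\<Psi> \<in> carrier_mat a b"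
    using unit by (simp add: unit_state_def)
  have unit_run: "unit_state m n (run ss x y \<Psi>)" if "x \<in> X" "y \<in> Y" for x y
    unfolding m_def n_def using unit_state_run[OF valid unit that] .
  \<comment> \<open>Outcome \<open>v\<close> is a product event: the sender's kept register avoids
    \<open>G\<close> and the lowest bit of the receiver's register is \<open>v\<close>. Restricting
    the rows of both local operators therefore selects it.\<close>
  obtain R S where RS: "R \<subseteq> {..<m}" "S \<subseteq> {..<n}"
    "\<And>r s. r < m \<Longrightarrow> s < n \<Longrightarrow> outcome (last ss) G r s = Some v \<longleftrightarrow> r \<in> R \<and> s \<in> S"
  proof (cases "last ss")
    case (AliceSends d U)
    show ?thesis
      by (rule that[of "{r. r < m \<and> r \<notin> G}" "{s. s < n \<and> odd s = v}"])
         (auto simp: AliceSends)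
  next
    case (BobSends d V)
    show ?thesis
      by (rule that[of "{r. r < m \<and> odd r = v}" "{s. s < n \<and> s \<notin> G}"])
         (auto simp: BobSends)
  qed
  have finRS: "finite R" "finite S"
    using RS(1,2) finite_subset by auto
  define I where "I = {..<(2::nat) ^ q} \<times> {..<a}"
  define J where "J = {..<(2::nat) ^ q} \<times> {..<b}"
  define A where "A p = (\<lambda>r (c, i). local_op (alice_view ss) (fst p) c r i)" for p :: "'x \<times> 'y"
  define B where "B p = (\<lambda>s (c, j). local_op (bob_view ss) (snd p) c s j)" for p :: "'x \<times> 'y"
  \<comment> \<open>One copy of \<open>\<Psi>\<close> for each string \<open>c\<close>, held by both
    parties, forces the two operators to use the same string.\<close>
  define \<psi> :: "nat \<times> nat \<Rightarrow> nat \<times> nat \<Rightarrow> complex"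
    where "\<psi> = (\<lambda>(c, i) (c', j). if c = c' then \<Psi> $$ (i, j) else 0)"
  have norm_\<psi>: "(\<Sum>i\<in>I. \<Sum>j\<in>J. (cmod (\<psi> i j))\<^sup>2) = 2 ^ q"
  proof -
    have "(\<Sum>i\<in>I. \<Sum>j\<in>J. (cmod (\<psi> i j))\<^sup>2)
        = (\<Sum>c<(2::nat) ^ q. \<Sum>i<a. \<Sum>c'<(2::nat) ^ q. if c = c' then \<Sum>j<b. (cmod (\<Psi> $$ (i, j)))\<^sup>2 else 0)"
      unfolding I_def J_def \<psi>_def sum.cartesian_product' by (intro sum.cong refl) auto
    also have "\<dots> = 2 ^ q"
      using unit by (simp add: unit_state_def)
    finally show ?thesis .
  qed
  \<comment> \<open>Operators are indexed by pairs so that \<open>F\<close> itself is the index set;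
    \<open>y'\<close> and \<open>x'\<close> are the ignored components.\<close>
  have run_amp: "run ss x y \<Psi> $$ (r, s) = amplitude I J (A (x, y')) \<psi> (B (x', y)) r s"
    if "x \<in> X" "y \<in> Y" "r \<in> R" "s \<in> S" for x y x' y' r s
  proof -
    have "amplitude I J (A (x, y')) \<psi> (B (x', y)) r s
        = (\<Sum>c<(2::nat) ^ q. \<Sum>i<a. \<Sum>c'<(2::nat) ^ q. if c = c' then \<Sum>j<b.
             local_op (alice_view ss) x c r i * \<Psi> $$ (i, j) * local_op (bob_view ss) y c s j else 0)"
      unfolding amplitude_def I_def J_def \<psi>_def A_def B_def sum.cartesian_product'
      by (intro sum.cong refl) auto
    also have "\<dots> = (\<Sum>c<(2::nat) ^ q. \<Sum>i<a. \<Sum>j<b.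
             local_op (alice_view ss) x c r i * \<Psi> $$ (i, j) * local_op (bob_view ss) y c s j)"
      by simp
    also have "\<dots> = run ss x y \<Psi> $$ (r, s)"
      unfolding q_def using that RS(1,2)
      by (intro run_entry[OF valid \<Psi>, symmetric]) (auto simp: m_def n_def)
    finally show ?thesis ..
  qed
  have prob: "outcome_prob \<Psi> ss G x y (Some v)
      = (\<Sum>r\<in>R. \<Sum>s\<in>S. (cmod (amplitude I J (A (x, y')) \<psi> (B (x', y)) r s))\<^sup>2)"
    if "x \<in> X" "y \<in> Y" for x y x' y'
  proof -
    have "dim_row (run ss x y \<Psi>) = m" "dim_col (run ss x y \<Psi>) = n"
      using unit_run[OF that] by (auto simp: unit_state_def)
    hence "{(i, j). i < dim_row (run ss x y \<Psi>) \<and> j < dim_col (run ss x y \<Psi>) \<and>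
              outcome (last ss) G i j = Some v} = R \<times> S"
      using RS by auto
    hence "outcome_prob \<Psi> ss G x y (Some v) = (\<Sum>r\<in>R. \<Sum>s\<in>S. (cmod (run ss x y \<Psi> $$ (r, s)))\<^sup>2)"
      by (simp add: outcome_prob_def Let_def sum.cartesian_product')
    thus ?thesis
      using that by (simp add: run_amp[where x' = x' and y' = y'])
  qed
  have amp_zero: "\<forall>r\<in>R. \<forall>s\<in>S. amplitude I J (A (x, y')) \<psi> (B (x', y)) r s = 0"
    if "x \<in> X" "y \<in> Y" "f x y \<noteq> v" for x y x' y'
  proof -
    have "v = (\<not> f x y)"
      using that by auto
    hence "outcome_prob \<Psi> ss G x y (Some v) = 0"
      using err that by simp
    thus ?thesis
      using finRS by (simp add: prob[OF that(1,2), where x' = x' and y' = y'] sum_nonneg_eq_0_iff sum_nonneg)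
  qed
  have XY: "fst p \<in> X" "snd p \<in> Y" and f_eq: "f (fst p) (snd p) = v" if "p \<in> F" for p
    using fs that by (auto simp: fooling_set_def)
  define P where "P p = (\<Sum>r\<in>R. \<Sum>s\<in>S. (cmod (amplitude I J (A p) \<psi> (B p) r s))\<^sup>2)" for p
  \<comment> \<open>The wrong value has probability 0 and giving up at most 1/2.\<close>
  have half: "1 / 2 \<le> P p" if "p \<in> F" for p
  proof -
    have "outcome_prob \<Psi> ss G (fst p) (snd p) (Some (\<not> v)) = 0"
      using err[OF XY[OF that]] f_eq[OF that] by simp
    hence "1 / 2 \<le> outcome_prob \<Psi> ss G (fst p) (snd p) (Some v)"
      using outcome_prob_total[OF unit_run[OF XY[OF that]], of G] giveup[OF XY[OF that]]
      by (cases v) auto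
    thus ?thesis
      unfolding P_def prob[OF XY[OF that], of "snd p" "fst p"] by simp
  qed
  define KA KB :: real where "KA = 2 ^ sends (alice_view ss)" and "KB = 2 ^ sends (bob_view ss)"
  have KAB: "KA * KB = 2 ^ q"
    unfolding KA_def KB_def q_def sends_views[symmetric] by (simp add: power_add)
  have "(\<Sum>p\<in>F. (P p)\<^sup>2) \<le> (KA * KB * (\<Sum>i\<in>I. \<Sum>j\<in>J. (cmod (\<psi> i j))\<^sup>2))\<^sup>2"
    unfolding P_def
  proof (rule fooling_amplitudes_bound)
    show "sq_bounded KA R I (A p)" if "p \<in> F" for p
      using local_op_sq_bounded[OF local_valid_alice_view[OF valid XY(1)[OF that]]]
      unfolding A_def I_def KA_def q_def m_def[symmetric] length_alice_view
      by (rule sq_bounded_mono) (use RS in auto)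
    show "sq_bounded KB S J (B p)" if "p \<in> F" for p
      using local_op_sq_bounded[OF local_valid_bob_view[OF valid XY(2)[OF that]]]
      unfolding B_def J_def KB_def q_def n_def[symmetric] length_bob_view
      by (rule sq_bounded_mono) (use RS in auto)
    \<comment> \<open>On one of the two crossed inputs \<open>f\<close> differs from
      \<open>v\<close>, so the protocol never outputs \<open>v\<close> there.\<close>
    show "(\<forall>r\<in>R. \<forall>s\<in>S. amplitude I J (A p) \<psi> (B p') r s = 0) \<or>
          (\<forall>r\<in>R. \<forall>s\<in>S. amplitude I J (A p') \<psi> (B p) r s = 0)"
      if "p \<in> F" "p' \<in> F" "p \<noteq> p'" for p p'
    proof -
      have "f (fst p) (snd p') \<noteq> v \<or> f (fst p') (snd p) \<noteq> v"
        using fs that unfolding fooling_set_def by (cases p; cases p') fastforce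
      thus ?thesis
        using amp_zero[of "fst p" "snd p'" "snd p" "fst p'"]
          amp_zero[of "fst p'" "snd p" "snd p'" "fst p"] XY that by auto
    qed
  qed (use fin finRS in \<open>auto simp: I_def J_def KAB\<close>)
  also have "\<dots> = 2 ^ (4 * q)"
    unfolding KAB norm_\<psi> by (simp flip: power_add power_mult)
  finally have "(\<Sum>p\<in>F. (P p)\<^sup>2) \<le> 2 ^ (4 * q)" .
  moreover have "(\<Sum>p\<in>F. (1 / 2)\<^sup>2) \<le> (\<Sum>p\<in>F. (P p)\<^sup>2)"
    by (intro sum_mono power_mono half) auto
  ultimately show ?thesis
    by (simp add: power2_eq_square power_add q_def)
qed

section \<open>Existence of a protocol\<close>

text \<open>\<open>Q0\<close> is defined by \<open>LEAST\<close>, whose value is unspecified unless some protocol exists.\<close>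

lemma isometry_inj_on:
  assumes "inj_on g {..<n}" "\<And>s. s < n \<Longrightarrow> g s < m"
  shows "isometry m n (mat m n (\<lambda>(r, s). of_bool (r = g s)))"
proof -
  let ?U = "mat m n (\<lambda>(r, s). of_bool (r = g s)) :: complex mat"
  have "mat_adjoint ?U * ?U = 1\<^sub>m n"
  proof (rule eq_matI)
    fix i j assume "i < dim_row (1\<^sub>m n :: complex mat)" "j < dim_col (1\<^sub>m n :: complex mat)"
    hence ij: "i < n" "j < n" by auto
    have "(mat_adjoint ?U * ?U) $$ (i, j) = (\<Sum>r<m. cnj (?U $$ (r, i)) * ?U $$ (r, j))"
      by (rule mat_adjoint_mult_entry) (use ij in auto)
    also have "\<dots> = (\<Sum>r<m. if r = g i then of_bool (i = j) else 0)"
      using ij assms(1) by (intro sum.cong) (auto dest: inj_onD)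
    finally show "(mat_adjoint ?U * ?U) $$ (i, j) = (1\<^sub>m n :: complex mat) $$ (i, j)"
      using ij assms(2) by simp
  qed (auto simp: mat_adjoint_def)
  thus ?thesis
    by (simp add: isometry_def)
qed

text \<open>For each \<open>z\<close> Alice sends the bit telling whether \<open>x = z\<close>. Her
  register has dimension 1 throughout, so her operator just prepares that bit.\<close>

definition announce :: "'x list \<Rightarrow> ('x, 'y) step list" where
  "announce = map (\<lambda>z. AliceSends 1 (\<lambda>x. mat 2 1 (\<lambda>(r, s). of_bool (r = of_bool (x = z)))))"

text \<open>The basis state of Bob's register after the announcements; the latest bit is the
  lowest.\<close>

definition announced :: "'x list \<Rightarrow> 'x \<Rightarrow> nat \<Rightarrow> nat" where
  "announced zs x j = fold (\<lambda>z j. 2 * j + of_bool (x = z)) zs j"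

definition basis_row :: "nat \<Rightarrow> nat \<Rightarrow> complex mat" where
  "basis_row n j = mat 1 n (\<lambda>(_, k). of_bool (k = j))"

lemma valid_steps_announce:
  "valid_steps X Y 1 n (announce zs @ ss) \<longleftrightarrow> valid_steps X Y 1 (2 ^ length zs * n) ss"
proof (induction zs arbitrary: n)
  case (Cons z zs)
  have "isometry 2 1 (mat 2 1 (\<lambda>(r, s). of_bool (r = of_bool (x = z))))" for x
    by (rule isometry_inj_on) (auto simp: inj_on_def)
  thus ?case
    using Cons[of "2 * n"] by (simp add: announce_def mult_ac)
qed (simp add: announce_def)

lemma run_announce:
  assumes "j < n"
  shows "run (announce zs @ ss) x y (basis_row n j)
       = run ss x y (basis_row (2 ^ length zs * n) (announced zs x j))"
  using assms
proof (induction zs arbitrary: n j)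
  case (Cons z zs)
  let ?U = "mat 2 1 (\<lambda>(r, s). of_bool (r = of_bool (x = z))) :: complex mat"
  have "qubit_to_Bob (?U * basis_row n j) = basis_row (2 * n) (2 * j + of_bool (x = z))"
  proof (rule eq_matI)
    fix i k assume "i < dim_row (basis_row (2 * n) (2 * j + of_bool (x = z)))"
      "k < dim_col (basis_row (2 * n) (2 * j + of_bool (x = z)))"
    hence ik: "i = 0" "k < 2 * n"
      by (auto simp: basis_row_def)
    have "qubit_to_Bob (?U * basis_row n j) $$ (i, k)
        = (?U * basis_row n j) $$ (k mod 2, k div 2)"
      using ik by (simp add: qubit_to_Bob_def basis_row_def)
    also have "\<dots> = (\<Sum>l<1. ?U $$ (k mod 2, l) * basis_row n j $$ (l, k div 2))"
      using ik by (intro mult_mat_entry[of _ 2 _ _ n]) (auto simp: basis_row_def)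
    also have "\<dots> = of_bool (k mod 2 = of_bool (x = z) \<and> k div 2 = j)"
      using ik by (simp add: basis_row_def)
    also have "(k mod 2 = of_bool (x = z) \<and> k div 2 = j) \<longleftrightarrow> k = 2 * j + of_bool (x = z)"
      by (cases "x = z") (simp_all, presburger+)
    finally show "qubit_to_Bob (?U * basis_row n j) $$ (i, k)
        = basis_row (2 * n) (2 * j + of_bool (x = z)) $$ (i, k)"
      using ik by (simp add: basis_row_def)
  qed (auto simp: qubit_to_Bob_def basis_row_def)
  thus ?case
    using Cons.IH[of "2 * j + of_bool (x = z)" "2 * n"] Cons.prems
    by (cases "x = z") (simp_all add: announce_def announced_def mult_ac)
qed (simp add: announce_def announced_def)

lemma announced_less: "j < n \<Longrightarrow> announced zs x j < 2 ^ length zs * n"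
proof (induction zs arbitrary: j n)
  case (Cons z zs)
  show ?case
    using Cons.IH[of "2 * j + of_bool (x = z)" "2 * n"] Cons.prems
    by (cases "x = z") (simp_all add: announced_def mult_ac)
qed (simp add: announced_def)

text \<open>This makes the code injective on \<open>set zs\<close>. The latest bit is compared by
  parity, hence the induction from the end of the list.\<close>

lemma announced_eqD:
  "announced zs x j = announced zs x' j \<Longrightarrow> z \<in> set zs \<Longrightarrow> x = z \<longleftrightarrow> x' = z"
proof (induction zs rule: rev_induct)
  case (snoc w zs)
  have "2 * announced zs x j + of_bool (x = w) = 2 * announced zs x' j + of_bool (x' = w)"
    using snoc.prems by (simp add: announced_def)
  hence "announced zs x j = announced zs x' j \<and> (x = w \<longleftrightarrow> x' = w)"
    by (cases "x = w"; cases "x' = w") (simp_all, presburger+)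
  thus ?case
    using snoc by auto
qed simp

text \<open>Alice announces \<open>x\<close>, and Bob evaluates \<open>f\<close> and sends the
  value. Nobody ever gives up, so \<open>G\<close> is empty.\<close>

lemma las_vegas_exists:
  fixes X :: "'x set" and Y :: "'y set"
  assumes "finite X"
  shows "\<exists>a b \<Psi> (ss :: ('x, 'y) step list) G. las_vegas X Y f a b \<Psi> ss G"
proof -
  obtain zs where zs: "set zs = X"
    using finite_list[OF assms] by blast
  define N :: nat where "N = 2 ^ length zs"
  define code where "code x = announced zs x 0" for x
  \<comment> \<open>The answer is false on values \<open>s\<close> that encode no \<open>x\<close>.
    \<open>V y\<close> keeps \<open>s\<close> next to the answer bit, so it is an isometry whatever
    the bit is.\<close>
  define ans where "ans y s = (\<exists>x\<in>X. code x = s \<and> f x y)" for y s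
  define V where "V y = mat (2 * N) N (\<lambda>(r, s). of_bool (r = 2 * s + of_bool (ans y s)) :: complex)"
    for y
  define ss where "ss = announce zs @ [BobSends N V]"
  have ans: "ans y (code x) = f x y" if "x \<in> X" for x y
  proof -
    have "x' = x" if "x' \<in> X" "code x' = code x" for x'
      using announced_eqD[of zs x' 0 x x'] that \<open>x \<in> X\<close> zs by (auto simp: code_def)
    thus ?thesis
      using that by (auto simp: ans_def)
  qed
  have code: "code x < N" for x
    using announced_less[of 0 1 zs x] by (simp add: code_def N_def)
  have V: "isometry (2 * N) N (V y)" for y
    unfolding V_def
  proof (rule isometry_inj_on)
    show "inj_on (\<lambda>s. 2 * s + of_bool (ans y s) :: nat) {..<N}"
    proof (rule inj_onI)
      fix s t assume "2 * s + of_bool (ans y s) = 2 * t + (of_bool (ans y t) :: nat)"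
      thus "s = t"
        by (cases "ans y s"; cases "ans y t"; simp; presburger)
    qed
  qed auto
  have run: "run ss x y (basis_row 1 0)
      = mat 2 N (\<lambda>(i, k). of_bool (k = code x \<and> i = of_bool (f x y)))" if "x \<in> X" for x y
  proof -
    have "run ss x y (basis_row 1 0) = qubit_to_Alice (basis_row N (code x) * transpose_mat (V y))"
      unfolding ss_def by (simp add: run_announce N_def code_def)
    also have "\<dots> = mat 2 N (\<lambda>(i, k). of_bool (k = code x \<and> i = of_bool (f x y)))"
    proof (rule eq_matI)
      fix i k
      assume "i < dim_row (mat 2 N (\<lambda>(i, k). of_bool (k = code x \<and> i = of_bool (f x y)) :: complex))"
        "k < dim_col (mat 2 N (\<lambda>(i, k). of_bool (k = code x \<and> i = of_bool (f x y)) :: complex))"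
      hence ik: "i < 2" "k < N" by auto
      have "qubit_to_Alice (basis_row N (code x) * transpose_mat (V y)) $$ (i, k)
          = (basis_row N (code x) * transpose_mat (V y)) $$ (0, 2 * k + i)"
        using ik by (simp add: qubit_to_Alice_def basis_row_def V_def)
      also have "\<dots> = (\<Sum>l<N. basis_row N (code x) $$ (0, l) * transpose_mat (V y) $$ (l, 2 * k + i))"
        using ik by (intro mult_mat_entry[of _ 1 _ _ "2 * N"]) (auto simp: basis_row_def V_def)
      also have "\<dots> = (\<Sum>l<N. if l = code x then V y $$ (2 * k + i, l) else 0)"
        using ik by (intro sum.cong) (auto simp: basis_row_def V_def)
      also have "\<dots> = of_bool (2 * k + i = 2 * code x + of_bool (f x y))"
        using ik code[of x] by (simp add: V_def ans[OF that])
      also have "2 * k + i = 2 * code x + of_bool (f x y) \<longleftrightarrow> k = code x \<and> i = of_bool (f x y)"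
        using ik by (cases "f x y") (simp_all, presburger+)
      finally show "qubit_to_Alice (basis_row N (code x) * transpose_mat (V y)) $$ (i, k)
          = mat 2 N (\<lambda>(i, k). of_bool (k = code x \<and> i = of_bool (f x y))) $$ (i, k)"
        using ik by simp
    qed (auto simp: qubit_to_Alice_def basis_row_def V_def)
    finally show ?thesis .
  qed
  have last: "last ss = BobSends N V"
    by (simp add: ss_def)
  have "las_vegas X Y f 1 1 (basis_row 1 0) ss {}"
    unfolding las_vegas_def
  proof (intro conjI ballI)
    show "unit_state 1 1 (basis_row 1 0)"
      by (simp add: unit_state_def basis_row_def)
    show "ss \<noteq> []"
      by (simp add: ss_def)
    show "valid_steps X Y 1 1 ss"
      unfolding ss_def valid_steps_announce using V by (simp flip: N_def)
    fix x y assume x: "x \<in> X"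
    show "outcome_prob (basis_row 1 0) ss {} x y (Some (\<not> f x y)) = 0"
      unfolding outcome_prob_def Let_def last run[OF x]
      by (intro sum.neutral) (auto intro: odd_pos)
    show "outcome_prob (basis_row 1 0) ss {} x y None \<le> 1 / 2"
      unfolding outcome_prob_def Let_def last by simp
  qed
  thus ?thesis
    by blast
qed

section \<open>The bound for \<open>Q0\<close>\<close>

lemma fool_attained:
  assumes "finite X" "finite Y"
  shows "\<exists>v F. fooling_set X Y f v F \<and> card F = fool X Y f"
proof -
  have "\<exists>F. fooling_set X Y f v F \<and> card F = fool_val X Y f v" for v
  proof -
    let ?C = "{card F | F. fooling_set X Y f v F}"
    have "?C \<subseteq> card ` Pow (X \<times> Y)"
      by (auto simp: fooling_set_def)
    hence "finite ?C"
      by (rule finite_subset) (use assms in auto)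
    \<comment> \<open>The empty set is fooling, so the maximum is taken over a nonempty set.\<close>
    moreover have "card {} \<in> ?C"
      by (force simp: fooling_set_def)
    ultimately have "Max ?C \<in> ?C"
      by (intro Max_in) auto
    thus ?thesis
      by (auto simp: fool_val_def)
  qed
  thus ?thesis
    unfolding fool_def max_def by (metis (full_types))
qed

theorem mainTheorem5:
  fixes X :: "'x set" and Y :: "'y set" and f :: "'x \<Rightarrow> 'y \<Rightarrow> bool"
  assumes "finite X" and "finite Y"
  shows "real (Q0 X Y f) \<ge> 1 / 4 * log 2 (real (fool X Y f)) - 1 / 2"
proof -
  have "\<exists>q a b \<Psi> (ss :: ('x, 'y) step list) G. las_vegas X Y f a b \<Psi> ss G \<and> length ss = q"
    using las_vegas_exists[OF assms(1)] by blast
  hence "\<exists>a b \<Psi> (ss :: ('x, 'y) step list) G. las_vegas X Y f a b \<Psi> ss G \<and> length ss = Q0 X Y f"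
    unfolding Q0_def by (rule LeastI_ex)
  then obtain a b \<Psi> G and ss :: "('x, 'y) step list"
    where lv: "las_vegas X Y f a b \<Psi> ss G" "length ss = Q0 X Y f"
    by blast
  obtain v F where F: "fooling_set X Y f v F" "card F = fool X Y f"
    using fool_attained[OF assms] by blast
  have "finite F"
    using F(1) assms finite_subset by (auto simp: fooling_set_def)
  hence le: "real (fool X Y f) \<le> 2 ^ (4 * Q0 X Y f + 2)"
    using las_vegas_fooling_set_bound[OF lv(1) F(1)] lv(2) F(2) by simp
  show ?thesis
  proof (cases "fool X Y f = 0")
    \<comment> \<open>The default value \<open>log 2 0 = 0\<close> makes the right-hand side
      -1/2.\<close>
    case True
    thus ?thesis
      by (simp add: log_def)
  next
    case False
    hence "log 2 (real (fool X Y f)) \<le> log 2 (2 ^ (4 * Q0 X Y f + 2))"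
      using le by (intro log_mono) auto
    also have "\<dots> = real (4 * Q0 X Y f + 2)"
      by (rule log_pow_cancel) auto
    finally show ?thesis
      by simp
  qed
qed

end
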